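(* Let $X$ be a Tychonoff space that is hereditarily weakly open-compact attainable, i.e. every subspace of $X$ is weakly open-compact attainable. Then $X$ is Fréchet--Urysohn.
   Context: All topological spaces are assumed to be Tychonoff. A space $Y$ is weakly open-compact attainable if for every non-closed open subset $W$ of $Y$ there are a point $z\in\overline{W}\setminus W$ and a compact subset $K$ of $Y$ such that $z\in K\cap\overline{K\cap W}$. A space $X$ is Fréchet--Urysohn if for every $A\subseteq X$ and every $a\in\overline{A}\setminus A$ there is a sequence $\{a_n\}_{n\in\omega}\subseteq A$ converging to $a$. *)

theory Defs
  imports "HOL-Analysis.Analysis"
begin

definition tychonoff_space :: "'a topology \<Rightarrow> bool" where
  "tychonoff_space X \<longleftrightarrow> completely_regular_space X \<and> t1_space X"

definition weakly_open_compact_attainable :: "'a topology \<Rightarrow> bool" where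
  "weakly_open_compact_attainable Y \<longleftrightarrow>
     (\<forall>W. openin Y W \<and> \<not> closedin Y W \<longrightarrow>
        (\<exists>z K. z \<in> Y closure_of W - W \<and> compactin Y K \<and> z \<in> K \<inter> Y closure_of (K \<inter> W)))"

definition hereditarily_weakly_open_compact_attainable :: "'a topology \<Rightarrow> bool" where
  "hereditarily_weakly_open_compact_attainable X \<longleftrightarrow>
     (\<forall>S. S \<subseteq> topspace X \<longrightarrow> weakly_open_compact_attainable (subtopology X S))"

definition frechet_urysohn_space :: "'a topology \<Rightarrow> bool" where
  "frechet_urysohn_space X \<longleftrightarrow>
     (\<forall>A a. A \<subseteq> topspace X \<and> a \<in> X closure_of A - A \<longrightarrow>
        (\<exists>s :: nat \<Rightarrow> 'a. range s \<subseteq> A \<and> limitin X s a sequentially))"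

end

theory Submission
  imports Defs
begin

text \<open>Given \<open>a\<close> in the closure of \<open>A\<close>, choose a maximal disjoint family \<open>F\<close> of open subsets of
  \<open>A\<close> whose closures miss \<open>a\<close>. Its union \<open>W\<close> is dense in \<open>A\<close>, so attainability of the subspace
  \<open>W \<union> {a}\<close> yields a compact \<open>L \<subseteq> W \<union> {a}\<close> with \<open>a\<close> in the closure of \<open>L \<inter> W\<close>. Infinitely many
  members of \<open>F\<close> meet \<open>L\<close>, while by compactness only finitely many meet \<open>L\<close> outside a given
  neighbourhood of \<open>a\<close>. Hence points of \<open>L\<close> chosen from distinct members of \<open>F\<close> converge
  to \<open>a\<close>.\<close>

text \<open>Zorn's lemma applied to disjoint families of sets satisfying \<open>P\<close>. A set
  \<open>V\<close> that could be added to the maximal family already belongs to it, hence is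
  disjoint from itself.\<close>

lemma ex_maximal_disjoint_family:
  obtains F where "pairwise disjnt F" "\<And>U. U \<in> F \<Longrightarrow> P U"
    "\<And>V. P V \<Longrightarrow> disjnt V (\<Union>F) \<Longrightarrow> V = {}"
proof -
  let ?C = "{F. pairwise disjnt F \<and> (\<forall>U\<in>F. P U)}"
  have "\<Union>c \<in> ?C" if "subset.chain ?C c" for c
    using that unfolding subset_chain_def by (auto intro!: pairwise_chain_Union simp: chain_subset_def)
  then obtain F where F: "F \<in> ?C" and max: "\<And>G. G \<in> ?C \<Longrightarrow> F \<subseteq> G \<Longrightarrow> G = F"
    using subset_Zorn'[of ?C] by meson
  have "V = {}" if V: "P V" "disjnt V (\<Union>F)" for V
  proof -
    have "insert V F \<in> ?C"
      using F V by (auto simp: pairwise_insert disjnt_def)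
    then have "V \<in> F"
      using max by blast
    then show ?thesis
      using V by (auto simp: disjnt_def)
  qed
  with F that show thesis
    by auto
qed

lemma sequence_from_disjoint_open_family:
  assumes disj: "pairwise disjnt F"
    and op: "\<And>U. U \<in> F \<Longrightarrow> openin X U"
    and notcl: "\<And>U. U \<in> F \<Longrightarrow> a \<notin> X closure_of U"
    and L: "compactin X L" "L \<subseteq> insert a (\<Union>F)"
    and a: "a \<in> X closure_of (L \<inter> \<Union>F)"
  obtains s :: "nat \<Rightarrow> 'a" where "range s \<subseteq> L \<inter> \<Union>F" "limitin X s a sequentially"
proof -
  define G where "G = {U \<in> F. L \<inter> U \<noteq> {}}"
  \<comment> \<open>Closure commutes with finite unions, so finitely many members of
    \<open>F\<close> cannot accumulate at \<open>a\<close>.\<close>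
  have "infinite G"
  proof
    assume "finite G"
    then have "X closure_of \<Union>G = (\<Union>U\<in>G. X closure_of U)"
      by (rule closure_of_Union)
    moreover have "L \<inter> \<Union>F \<subseteq> \<Union>G"
      unfolding G_def by auto
    ultimately show False
      using a notcl closure_of_mono[of "L \<inter> \<Union>F" "\<Union>G" X] unfolding G_def by blast
  qed
  then obtain u :: "nat \<Rightarrow> 'a set" where u: "inj u" "range u \<subseteq> G"
    using infinite_countable_subset by blast
  then have "\<forall>n. \<exists>x. x \<in> L \<inter> u n"
    unfolding G_def by blast
  then obtain s where s: "\<And>n. s n \<in> L \<inter> u n"
    by metis
  have uF: "u n \<in> F" for n
    using u(2) unfolding G_def by auto
  have "eventually (\<lambda>n. s n \<in> N) sequentially" if N: "openin X N" "a \<in> N" for N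
  proof -
    have "\<And>B. B \<in> insert N F \<Longrightarrow> openin X B" "L \<subseteq> \<Union>(insert N F)"
      using N op L(2) by auto
    then obtain T where T: "finite T" "T \<subseteq> insert N F" "L \<subseteq> \<Union>T"
      using compactinD[OF L(1)] by metis
    \<comment> \<open>By disjointness, \<open>u n\<close> is the only member of \<open>F\<close>
      containing \<open>s n\<close>, so a cover by \<open>N\<close> and members of \<open>F\<close>
      must use it. Injectivity of \<open>u\<close> then bounds the number of exceptional
      \<open>n\<close>.\<close>
    have "u n \<in> T" if "s n \<notin> N" for n
    proof -
      obtain B where B: "B \<in> T" "s n \<in> B"
        using T(3) s by blast
      then have "B \<in> F"
        using T(2) that by auto
      then have "B = u n"
        using disj uF[of n] B(2) s[of n] unfolding pairwise_def disjnt_def by blast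
      then show ?thesis
        using B by simp
    qed
    then have "{n. s n \<notin> N} \<subseteq> u -` T"
      by auto
    then have "finite {n. s n \<notin> N}"
      using finite_vimageI[OF T(1) u(1)] finite_subset by blast
    then show ?thesis
      by (simp add: eventually_cofinite flip: cofinite_eq_sequentially)
  qed
  moreover have "a \<in> topspace X"
    using a by (auto simp: in_closure_of)
  ultimately have "limitin X s a sequentially"
    by (auto simp: limitin_def)
  moreover have "range s \<subseteq> L \<inter> \<Union>F"
    using s uF by blast
  ultimately show thesis
    using that by blast
qed

text \<open>The Hausdorff property enters twice: separating \<open>a\<close> from the points of
  \<open>A\<close> makes \<open>W\<close> dense in \<open>A\<close>, and closedness of
  \<open>{a}\<close> keeps subsets of \<open>W\<close> that are open in \<open>A\<close> open in
  \<open>insert a W\<close>.\<close>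

lemma frechet_urysohn_if_Hausdorff:
  assumes haus: "Hausdorff_space X"
    and hered: "hereditarily_weakly_open_compact_attainable X"
  shows "frechet_urysohn_space X"
  unfolding frechet_urysohn_space_def
proof (intro allI impI)
  fix A a
  assume "A \<subseteq> topspace X \<and> a \<in> X closure_of A - A"
  then have A: "A \<subseteq> topspace X" and a: "a \<in> X closure_of A" "a \<notin> A"
    by auto
  have aX: "a \<in> topspace X"
    using a by (auto simp: in_closure_of)
  define P where "P U \<longleftrightarrow> openin (subtopology X A) U \<and> a \<notin> X closure_of U" for U
  obtain F where disj: "pairwise disjnt F" and FP: "\<And>U. U \<in> F \<Longrightarrow> P U"
    and max: "\<And>V. P V \<Longrightarrow> disjnt V (\<Union>F) \<Longrightarrow> V = {}"
    by (rule ex_maximal_disjoint_family[of P]) blast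
  define W where "W = \<Union>F"
  define Y where "Y = subtopology X (insert a W)"
  have Wop: "openin (subtopology X A) W"
    unfolding W_def using FP P_def by blast
  then have WA: "W \<subseteq> A"
    using openin_imp_subset by blast
  have aW: "a \<notin> W"
    using WA a by blast
  have topY: "topspace Y = insert a W"
    unfolding Y_def using WA A aX by auto
  have "p \<in> X closure_of W" if p: "p \<in> A" for p
    unfolding in_closure_of
  proof (intro conjI allI impI)
    show "p \<in> topspace X" using p A by auto
    fix T assume T: "p \<in> T \<and> openin X T"
    obtain M N where MN: "openin X M" "openin X N" "p \<in> M" "a \<in> N" "disjnt M N"
      using haus p A aX a(2) unfolding Hausdorff_space_def by (metis subsetD)
    \<comment> \<open>Shrinking \<open>T\<close> by \<open>M\<close> keeps the closure away from
      \<open>a\<close>, so \<open>?V\<close> satisfies \<open>P\<close>; it contains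
      \<open>p\<close>, so maximality forces it to meet \<open>W\<close>.\<close>
    let ?V = "A \<inter> (T \<inter> M)"
    have "a \<notin> X closure_of ?V"
      using MN by (auto simp: in_closure_of disjnt_def)
    moreover have "openin (subtopology X A) ?V"
      using T MN(1) by (simp add: openin_Int openin_subtopology_Int2)
    ultimately have "P ?V"
      by (simp add: P_def)
    then have "\<not> disjnt ?V W"
      using max[of ?V] p T MN(3) unfolding W_def by blast
    then show "\<exists>y. y \<in> W \<and> y \<in> T"
      by (auto simp: disjnt_def)
  qed
  then have "X closure_of A \<subseteq> X closure_of W"
    by (simp add: closure_of_minimal subsetI)
  then have aclW: "a \<in> Y closure_of W"
    using a(1) unfolding Y_def by (auto simp: closure_of_subtopology_open subset_insertI)
  have openY: "openin Y U" if "openin (subtopology X A) U" "U \<subseteq> W" for U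
  proof -
    obtain T where T: "openin X T" "U = T \<inter> A"
      using \<open>openin (subtopology X A) U\<close> by (auto simp: openin_subtopology)
    have "openin X (topspace X - {a})"
      using haus aX by (simp add: closedin_Hausdorff_singleton openin_diff)
    moreover have "U = T \<inter> (topspace X - {a}) \<inter> insert a W"
      using T that(2) WA A a(2) by blast
    ultimately show ?thesis
      unfolding Y_def openin_subtopology using T(1) openin_Int by metis
  qed
  have "weakly_open_compact_attainable Y"
    using hered WA A aX unfolding hereditarily_weakly_open_compact_attainable_def Y_def by auto
  moreover have "openin Y W"
    using openY Wop by blast
  moreover have "\<not> closedin Y W"
    using aclW aW by (metis closure_of_closedin)
  ultimately obtain z K where z: "z \<in> Y closure_of W - W" and K: "compactin Y K"
    "z \<in> Y closure_of (K \<inter> W)"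
    unfolding weakly_open_compact_attainable_def by blast
  \<comment> \<open>The only point of \<open>Y\<close> outside \<open>W\<close> is \<open>a\<close>,
    so attainability has no other choice of \<open>z\<close>.\<close>
  have "z = a"
    using z topY by (auto simp: in_closure_of)
  obtain s :: "nat \<Rightarrow> 'a" where s: "range s \<subseteq> K \<inter> \<Union>F" "limitin Y s a sequentially"
  proof (rule sequence_from_disjoint_open_family[OF disj _ _ K(1)])
    show "openin Y U" if "U \<in> F" for U
      using that FP openY unfolding P_def W_def by blast
    show "a \<notin> Y closure_of U" if "U \<in> F" for U
      using that FP closure_of_subtopology_subset[of X "insert a W" U] unfolding P_def Y_def by auto
    show "K \<subseteq> insert a (\<Union>F)"
      using compactin_subset_topspace[OF K(1)] topY W_def by simp
    show "a \<in> Y closure_of (K \<inter> \<Union>F)"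
      using K(2) \<open>z = a\<close> W_def by simp
  qed
  show "\<exists>s :: nat \<Rightarrow> 'a. range s \<subseteq> A \<and> limitin X s a sequentially"
  proof (intro exI conjI)
    show "range s \<subseteq> A"
      using s(1) WA unfolding W_def by blast
    show "limitin X s a sequentially"
      using s(2) unfolding Y_def by (simp add: limitin_subtopology)
  qed
qed

theorem theorem3p15:
  fixes X :: "'a topology"
  assumes "tychonoff_space X"
    and "hereditarily_weakly_open_compact_attainable X"
  shows "frechet_urysohn_space X"
  using assms frechet_urysohn_if_Hausdorff completely_regular_imp_regular_space
    regular_t1_imp_Hausdorff_space
  unfolding tychonoff_space_def by blast

end
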